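(* Let $a,b\ge1$ be coprime with $a\le b$, let $A_{ij}$ denote the coefficient of $u^iv^jw^{a+b-1-i-j}$ in $P_{a/b}(u,v,w)$, with $A_{ij}=0$ for pairs not corresponding to a monomial of $P_{a/b}$, and let $\Delta_{a/b}=\{(i,j)\in\mathbb{R}^2: i,j\ge0,\ \frac ia+\frac jb\ge1,\ i+j\le a+b-1\}$. Then the coefficients on the line $j=1$ and on the line $i+j=a+b-2$ are strictly log-concave: for every lattice point $(i,1)\in\Delta_{a/b}$, $A_{i,1}^2>A_{i-1,1}A_{i+1,1}$; and for every lattice point $(i,j)\in\Delta_{a/b}$ with $i+j=a+b-2$, $A_{i,j}^2>A_{i-1,j+1}A_{i+1,j-1}$.
   Context: Markov polynomials. Let $x,y,z$ be indeterminates. Consider the set consisting of all rationals $\rho\in[0,1]$, each written in lowest terms $\rho=a/b$ with integers $a\ge 0$, $b\ge 1$, together with the formal symbol $1/0$. Define Laurent polynomials $M_\rho(x,y,z)$ recursively by $M_{1/0}=y$, $M_{0/1}=x$, $M_{1/1}=\frac{x^2+y^2}{z}$, and: whenever $a/b$, $c/d$ are in this set with $|ad-bc|=1$ and $(a+2c)/(b+2d)\in[0,1]$, then $M_{\frac{a+2c}{b+2d}}=\big(M_{c/d}^2+M_{\frac{a+c}{b+d}}^2\big)/M_{a/b}$. This determines $M_\rho$ for every rational $\rho\in[0,1]$. Numerator. For coprime $1\le a\le b$, $P_{a/b}(u,v,w)$ denotes the homogeneous polynomial of degree $a+b-1$ such that $M_{a/b}(x,y,z)=P_{a/b}(x^2,y^2,z^2)/(x^{a-1}y^{b-1}z^{a+b-1})$;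 its existence is known. *)

theory Defs
  imports Complex_Main
begin

text \<open>Laurent polynomials in x,y,z are represented by their (real) values on
  the positive octant x,y,z > 0 (which determines them uniquely); outside the
  positive octant the function is set to 0 so that representations are canonical.\<close>

type_synonym lfun = "real \<Rightarrow> real \<Rightarrow> real \<Rightarrow> real"

definition restr :: "lfun \<Rightarrow> lfun" where
  "restr f = (\<lambda>x y z. if 0 < x \<and> 0 < y \<and> 0 < z then f x y z else 0)"

definition in_farey_set :: "nat \<times> nat \<Rightarrow> bool" where
  "in_farey_set p = (p = (1,0) \<or> (1 \<le> snd p \<and> fst p \<le> snd p \<and> coprime (fst p) (snd p)))"

inductive markov_val :: "nat \<times> nat \<Rightarrow> lfun \<Rightarrow> bool" where
  inf: "markov_val (1,0) (restr (\<lambda>x y z. y))"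
| zero: "markov_val (0,1) (restr (\<lambda>x y z. x))"
| one: "markov_val (1,1) (restr (\<lambda>x y z. (x^2 + y^2) / z))"
| step: "\<lbrakk> in_farey_set (a,b); in_farey_set (c,d);
           markov_val (a,b) f; markov_val (c,d) g; markov_val (a+c, b+d) h;
           \<bar>int a * int d - int b * int c\<bar> = 1;
           0 < b + 2*d; a + 2*c \<le> b + 2*d \<rbrakk>
         \<Longrightarrow> markov_val (a + 2*c, b + 2*d)
               (restr (\<lambda>x y z. ((g x y z)^2 + (h x y z)^2) / f x y z))"

definition markovM :: "nat \<Rightarrow> nat \<Rightarrow> lfun" where
  "markovM a b = (THE f. markov_val (a,b) f)"

definition is_markovP :: "nat \<Rightarrow> nat \<Rightarrow> (int \<Rightarrow> int \<Rightarrow> real) \<Rightarrow> bool" where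
  "is_markovP a b A \<longleftrightarrow>
     (\<forall>i j. A i j \<noteq> 0 \<longrightarrow> 0 \<le> i \<and> 0 \<le> j \<and> i + j \<le> int (a + b - 1)) \<and>
     (\<forall>x y z. 0 < x \<longrightarrow> 0 < y \<longrightarrow> 0 < z \<longrightarrow>
        markovM a b x y z =
          (\<Sum>i\<le>a+b-1. \<Sum>j\<le>a+b-1-i.
              A (int i) (int j) * (x^2)^i * (y^2)^j * (z^2)^(a+b-1-i-j))
          / (x^(a-1) * y^(b-1) * z^(a+b-1)))"

definition markovA :: "nat \<Rightarrow> nat \<Rightarrow> int \<Rightarrow> int \<Rightarrow> real" where
  "markovA a b = (THE A. is_markovP a b A)"

definition in_Delta :: "nat \<Rightarrow> nat \<Rightarrow> int \<Rightarrow> int \<Rightarrow> bool" where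
  "in_Delta a b i j \<longleftrightarrow> 0 \<le> i \<and> 0 \<le> j \<and> real_of_int i / real a + real_of_int j / real b \<ge> 1
     \<and> i + j \<le> int a + int b - 1"

end

theory Submission
  imports Defs
begin

text \<open>Write \<open>M\<^bsub>p/q\<^esub> = x y z F(x^2, y^2, z^2) / (x^p y^q z^(p+q))\<close>. For Farey neighbours with mediant
  the Markov equation becomes \<open>F1^2 m2 + F2^2 m1 + F3^2 = (u+v+w) F1 F2 F3\<close>, where
  \<open>m = u^p v^q w^(p+q)\<close>, so that the exchange relation turns into the division-free recursion
  \<open>F' = (u+v+w) F1 F3 - m1 F2\<close>. Since \<open>m1\<close> vanishes to high order at \<open>w = 0\<close> and at \<open>v = 0\<close>,
  the recursion can be solved to first order in \<open>w\<close> and in \<open>v\<close>: the coefficients on the two lines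
  are those of \<open>((b-1) u + (a-1) v) (u+v)^(a+b-3)\<close> and of
  \<open>u^a ((a+b-1) u + (3a-1) w) (u+w)^(b-3)\<close>. Both are linear forms times powers of a linear
  form, which makes them strictly log-concave.\<close>

section \<open>Homogeneous polynomial functions\<close>

text \<open>Homogeneous polynomials are kept as functions built up monomial by monomial. Closure
  under sums and products is then a plain induction, and coefficients are extracted only at the end,
  by \<open>hom_coeffs\<close>.\<close>

inductive hom :: "nat \<Rightarrow> lfun \<Rightarrow> bool" where
  zero: "hom n (\<lambda>u v w. 0)"
| monom_add: "\<lbrakk>hom n F; i + j + k = n\<rbrakk> \<Longrightarrow> hom n (\<lambda>u v w. c * u^i * v^j * w^k + F u v w)"

lemma hom_monom:
  assumes "i + j + k = n"
  shows "hom n (\<lambda>u v w. c * u^i * v^j * w^k)"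
  using hom.monom_add[OF hom.zero assms, of c] by simp

lemma hom_add: "hom n F \<Longrightarrow> hom n G \<Longrightarrow> hom n (\<lambda>u v w. F u v w + G u v w)"
proof (induction rule: hom.induct)
  case (monom_add n F i j k c)
  show ?case
    using hom.monom_add[OF monom_add.IH[OF monom_add.prems] monom_add.hyps(2), of c]
    by (simp add: add.assoc)
qed simp

lemma hom_monom_mult:
  assumes "hom n F"
  shows "hom (i + j + k + n) (\<lambda>u v w. c * u^i * v^j * w^k * F u v w)"
  using assms
proof (induction rule: hom.induct)
  case (zero n)
  then show ?case by (simp add: hom.zero)
next
  case (monom_add n F i' j' k' c')
  have "(i + i') + (j + j') + (k + k') = i + j + k + n"
    using monom_add.hyps by simp
  from hom.monom_add[OF monom_add.IH this, of "c * c'"] show ?case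
    by (simp add: algebra_simps power_add)
qed

lemma hom_mult: "hom n F \<Longrightarrow> hom m G \<Longrightarrow> hom (n + m) (\<lambda>u v w. F u v w * G u v w)"
proof (induction rule: hom.induct)
  case (zero n)
  then show ?case by (simp add: hom.zero)
next
  case (monom_add n F i j k c)
  show ?case
    using hom_add[OF hom_monom_mult[OF monom_add.prems, of i j k c, unfolded monom_add.hyps(2)]
        monom_add.IH[OF monom_add.prems]]
    by (simp add: distrib_right)
qed

lemma hom_diff:
  assumes "hom n F" "hom n G"
  shows "hom n (\<lambda>u v w. F u v w - G u v w)"
proof -
  have "hom n (\<lambda>u v w. - G u v w)"
    using hom_monom_mult[OF assms(2), of 0 0 0 "-1"] by simp
  from hom_add[OF assms(1) this] show ?thesis by simp
qed

lemma hom_coeffs: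
  assumes "hom n F"
  shows "\<exists>A. \<forall>u v w. F u v w = (\<Sum>i\<le>n. \<Sum>j\<le>n-i. A i j * u^i * v^j * w^(n-i-j))"
  using assms
proof (induction rule: hom.induct)
  case (zero n)
  show ?case by (rule exI[of _ "\<lambda>i j. 0"]) simp
next
  case (monom_add n F i j k c)
  then obtain A where A: "\<And>u v w. F u v w = (\<Sum>i\<le>n. \<Sum>j\<le>n-i. A i j * u^i * v^j * w^(n-i-j))"
    by blast
  have k: "k = n - i - j" and le: "i \<le> n" "j \<le> n - i"
    using monom_add.hyps by auto
  \<comment> \<open>The new monomial becomes a double sum with a Kronecker delta as coefficient, so
    that it merges with the sum for \<open>F\<close>.\<close>
  have "c * u^i * v^j * w^k = (\<Sum>i'\<le>n. \<Sum>j'\<le>n-i'. (if i' = i \<and> j' = j then c else 0) * u^i' * v^j' * w^(n-i'-j'))"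
    (is "_ = ?s") for u v w
  proof -
    have "(\<Sum>j'\<le>n-i'. (if i' = i \<and> j' = j then c else 0) * u^i' * v^j' * w^(n-i'-j'))
        = (if i' = i then c * u^i * v^j * w^k else 0)" for i'
    proof (cases "i' = i")
      case True
      then have "(\<Sum>j'\<le>n-i'. (if i' = i \<and> j' = j then c else 0) * u^i' * v^j' * w^(n-i'-j'))
          = (\<Sum>j'\<le>n-i. if j' = j then c * u^i * v^j * w^k else 0)"
        unfolding k by (intro sum.cong) auto
      then show ?thesis using True le by (simp add: sum.delta)
    qed simp
    then show ?thesis
      using le by (simp add: sum.delta)
  qed
  then show ?case
    by (intro exI[of _ "\<lambda>i' j'. (if i' = i \<and> j' = j then c else 0) + A i' j'"])
      (simp add: A distrib_right sum.distrib)
qed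

section \<open>Uniqueness of coefficients, and reading them off from first derivatives\<close>

text \<open>Values on the positive octant give agreement at positive points only; that is enough,
  since the difference would have infinitely many roots.\<close>

lemma polyfun_pos_unique:
  fixes f g :: "nat \<Rightarrow> real"
  assumes "\<And>t. 0 < t \<Longrightarrow> (\<Sum>i\<le>n. f i * t^i) = (\<Sum>i\<le>n. g i * t^i)" and "i \<le> n"
  shows "f i = g i"
proof (rule ccontr)
  assume "f i \<noteq> g i"
  then have "finite {t. (\<Sum>i\<le>n. (f i - g i) * t^i) = 0}"
    using assms(2) by (subst polyfun_finite_roots) auto
  moreover have "{0<..} \<subseteq> {t. (\<Sum>i\<le>n. (f i - g i) * t^i) = 0}"
    using assms(1) by (auto simp: left_diff_distrib sum_subtractf)
  ultimately have "finite {0::real<..}"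
    by (rule rev_finite_subset)
  then show False
    using infinite_Ioi by blast
qed

text \<open>Setting \<open>w = 1\<close> loses no coefficient of a homogeneous polynomial. What
  remains is compared first as a polynomial in \<open>u\<close> for each fixed \<open>v > 0\<close>,
  then as a polynomial in \<open>v\<close>.\<close>

lemma homogeneous_coeffs_unique:
  fixes A B :: "nat \<Rightarrow> nat \<Rightarrow> real"
  assumes eq: "\<And>u v w. 0 < u \<Longrightarrow> 0 < v \<Longrightarrow> 0 < w \<Longrightarrow>
      (\<Sum>i\<le>n. \<Sum>j\<le>n-i. A i j * u^i * v^j * w^(n-i-j)) =
      (\<Sum>i\<le>n. \<Sum>j\<le>n-i. B i j * u^i * v^j * w^(n-i-j))"
    and "i \<le> n" "j \<le> n - i"
  shows "A i j = B i j"
proof (rule polyfun_pos_unique[where f = "A i" and g = "B i" and n = "n - i"])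
  fix v :: real assume v: "0 < v"
  show "(\<Sum>j\<le>n-i. A i j * v^j) = (\<Sum>j\<le>n-i. B i j * v^j)"
  proof (rule polyfun_pos_unique[where f = "\<lambda>i. \<Sum>j\<le>n-i. A i j * v^j" and
          g = "\<lambda>i. \<Sum>j\<le>n-i. B i j * v^j" and n = n])
    fix u :: real assume "0 < u"
    from eq[OF this v zero_less_one]
    show "(\<Sum>i\<le>n. (\<Sum>j\<le>n-i. A i j * v^j) * u^i) = (\<Sum>i\<le>n. (\<Sum>j\<le>n-i. B i j * v^j) * u^i)"
      by (simp add: sum_distrib_left mult_ac)
  qed (use assms in auto)
qed (use assms in auto)

text \<open>At \<open>w = 0\<close> only the monomials linear in \<open>w\<close> survive
  differentiation. With \<open>n = a+b-1\<close> this gives the generating function of the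
  coefficients on the line \<open>i+j = a+b-2\<close>.\<close>

lemma DERIV_homogeneous_w:
  "((\<lambda>w. \<Sum>i\<le>n. \<Sum>j\<le>n-i. A i j * t^i * 1^j * w^(n-i-j)) has_real_derivative
     (\<Sum>i<n. A i (n-1-i) * t^i)) (at 0)"
proof -
  have "((\<lambda>w. \<Sum>i\<le>n. \<Sum>j\<le>n-i. A i j * t^i * 1^j * w^(n-i-j)) has_real_derivative
     (\<Sum>i\<le>n. \<Sum>j\<le>n-i. A i j * t^i * 1^j * (real (n-i-j) * 0^(n-i-j-1)))) (at 0)"
    by (auto intro!: derivative_eq_intros sum.cong)
  also have "(\<Sum>i\<le>n. \<Sum>j\<le>n-i. A i j * t^i * 1^j * (real (n-i-j) * 0^(n-i-j-1)))
      = (\<Sum>i\<le>n. if i < n then A i (n-1-i) * t^i else 0)"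
  proof (intro sum.cong refl)
    fix i assume "i \<in> {..n}"
    \<comment> \<open>For \<open>j = n-i\<close> the power is \<open>0^0 = 1\<close>, but the factor
      \<open>real (n-i-j)\<close> is 0. The guard \<open>i < n\<close> is there because truncated
      subtraction gives \<open>n-1-i = 0\<close> also for \<open>i = n\<close>.\<close>
    have "(\<Sum>j\<le>n-i. A i j * t^i * 1^j * (real (n-i-j) * 0^(n-i-j-1)))
        = (\<Sum>j\<le>n-i. if j = n-1-i then (if i < n then A i j * t^i else 0) else 0)"
      using \<open>i \<in> {..n}\<close> by (intro sum.cong refl) (auto simp: power_0_left)
    also have "\<dots> = (if i < n then A i (n-1-i) * t^i else 0)"
      by (subst sum.delta) auto
    finally show "(\<Sum>j\<le>n-i. A i j * t^i * 1^j * (real (n-i-j) * 0^(n-i-j-1)))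
        = (if i < n then A i (n-1-i) * t^i else 0)" .
  qed
  also have "\<dots> = (\<Sum>i<n. A i (n-1-i) * t^i)"
    by (intro sum.mono_neutral_cong_right) auto
  finally show ?thesis .
qed

text \<open>Likewise differentiation in \<open>v\<close> at 0 isolates \<open>j = 1\<close>; the
  index \<open>i = n\<close> drops out because \<open>j\<close> is then 0.\<close>

lemma DERIV_homogeneous_v:
  "((\<lambda>v. \<Sum>i\<le>n. \<Sum>j\<le>n-i. A i j * t^i * v^j * 1^(n-i-j)) has_real_derivative
     (\<Sum>i<n. A i 1 * t^i)) (at 0)"
proof -
  have "((\<lambda>v. \<Sum>i\<le>n. \<Sum>j\<le>n-i. A i j * t^i * v^j * 1^(n-i-j)) has_real_derivative
     (\<Sum>i\<le>n. \<Sum>j\<le>n-i. A i j * t^i * (real j * 0^(j-1)))) (at 0)"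
    by (auto intro!: derivative_eq_intros sum.cong)
  also have "(\<Sum>i\<le>n. \<Sum>j\<le>n-i. A i j * t^i * (real j * 0^(j-1)))
      = (\<Sum>i\<le>n. if i < n then A i 1 * t^i else 0)"
  proof (intro sum.cong refl)
    fix i assume "i \<in> {..n}"
    have "(\<Sum>j\<le>n-i. A i j * t^i * (real j * 0^(j-1)))
        = (\<Sum>j\<le>n-i. if j = 1 then A i j * t^i else 0)"
      by (intro sum.cong refl) (auto simp: power_0_left)
    then show "(\<Sum>j\<le>n-i. A i j * t^i * (real j * 0^(j-1)))
        = (if i < n then A i 1 * t^i else 0)"
      by (auto simp: sum.delta)
  qed
  also have "\<dots> = (\<Sum>i<n. A i 1 * t^i)"
    by (intro sum.mono_neutral_cong_right) auto
  finally show ?thesis .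
qed

section \<open>Uniqueness of the Markov values\<close>

text \<open>Write \<open>A/B\<close> for the new fraction. Its determinants with \<open>c/d\<close>
  and \<open>c'/d'\<close> are 1 or -1. Equal signs make \<open>d\<close> and \<open>d'\<close>
  congruent modulo \<open>B\<close>, opposite signs make \<open>d\<close> and \<open>-d'\<close>
  congruent; since \<open>2*d\<close> and \<open>2*d'\<close> are at most \<open>B\<close>, little
  room is left.\<close>

lemma farey_step_unique:
  fixes a b c d a' b' c' d' :: nat
  assumes det: "\<bar>int a * int d - int b * int c\<bar> = 1" "\<bar>int a' * int d' - int b' * int c'\<bar> = 1"
    and fst_eq: "a + 2*c = a' + 2*c'" and snd_eq: "b + 2*d = b' + 2*d'"
    and pos: "0 < b + 2*d" and le: "a + 2*c \<le> b + 2*d"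
  shows "a = a' \<and> b = b' \<and> c = c' \<and> d = d'"
proof -
  define A B where "A = int (a + 2*c)" and "B = int (b + 2*d)"
  have A: "A = int a + 2 * int c" "A = int a' + 2 * int c'"
    and B: "B = int b + 2 * int d" "B = int b' + 2 * int d'"
    using fst_eq snd_eq unfolding A_def B_def by linarith+
  have AB: "0 < B" "A \<le> B" "0 \<le> A" using pos le unfolding A_def B_def by linarith+
  \<comment> \<open>The terms \<open>2*c*d\<close> cancel, so \<open>e = b*c - a*d\<close>.\<close>
  define e e' where "e = int c * B - int d * A" and "e' = int c' * B - int d' * A"
  have e: "\<bar>e\<bar> = 1"
    using det(1) by (simp add: e_def A(1) B(1) algebra_simps abs_minus_commute)
  have e': "\<bar>e'\<bar> = 1"
    using det(2) by (simp add: e'_def A(2) B(2) algebra_simps abs_minus_commute)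
  have cop: "coprime B A"
  proof (rule coprimeI)
    fix k assume "k dvd B" "k dvd A"
    then have "k dvd e" by (simp add: e_def)
    then show "is_unit k" using e by (metis dvd_abs_iff)
  qed
  show ?thesis
  proof (cases "e = e'")
    case True
    then have eq: "(int c - int c') * B = (int d - int d') * A"
      by (simp add: e_def e'_def algebra_simps)
    then have "B dvd (int d - int d') * A" by (metis dvd_triv_right)
    then have "B dvd int d - int d'" using cop by (simp add: coprime_dvd_mult_left_iff)
    moreover have "\<bar>int d - int d'\<bar> < B" using B AB by linarith
    ultimately have "int d - int d' = 0" using zdvd_not_zless[of "\<bar>int d - int d'\<bar>" B] by fastforce
    then have "d = d'" "c = c'" using eq AB by auto
    then show ?thesis using fst_eq snd_eq by simp
  next
    case False
    then have "e + e' = 0" using e e' by linarith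
    then have eq: "(int c + int c') * B = (int d + int d') * A"
      by (simp add: e_def e'_def algebra_simps)
    then have "B dvd (int d + int d') * A" by (metis dvd_triv_right)
    then have "B dvd int d + int d'" using cop by (simp add: coprime_dvd_mult_left_iff)
    \<comment> \<open>As \<open>d + d'\<close> lies between 0 and \<open>B\<close>, only the two
      ends remain, and both are contradictory: the first gives \<open>c = B = 1\<close> against
      \<open>A \<le> B\<close>, the second gives \<open>a = a' = 1\<close> and
      \<open>c = c'\<close>, where \<open>A = 2*c + 1\<close> cannot equal
      \<open>c + c'\<close>.\<close>
    then consider "d = 0" "d' = 0" | "B \<le> int d + int d'"
      using zdvd_imp_le by fastforce
    then show ?thesis
    proof cases
      case 1
      then have "int c * B = 1" using e AB by (simp add: e_def abs_mult)
      then have "B = 1" "c = 1" using AB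
        by (auto simp: zmult_eq_1_iff)
      then show ?thesis using AB A by linarith
    next
      case 2
      then have *: "b = 0" "b' = 0" "d = d'" "B = 2 * int d" using B by linarith+
      then have "d = 1" using det by (simp add: abs_mult zmult_eq_1_iff)
      then have "int c + int c' = A" using eq * by simp
      then show ?thesis using * fst_eq A \<open>d = 1\<close> det by auto
    qed
  qed
qed

text \<open>Entries at most 1 would force \<open>c = d = 0\<close>, which is not in the Farey set.
  This keeps \<open>step\<close> apart from the base rules.\<close>

lemma farey_step_not_base:
  assumes "in_farey_set (c, d)" "\<bar>int a * int d - int b * int c\<bar> = 1" "a + 2*c \<le> b + 2*d"
  shows "(a + 2*c, b + 2*d) \<notin> {(1, 0), (0, 1), (1, 1)}"
proof
  assume *: "(a + 2*c, b + 2*d) \<in> {(1, 0), (0, 1), (1, 1)}"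
  then have "c = 0" "d = 0" by auto
  then show False using assms(1) by (simp add: in_farey_set_def)
qed

text \<open>The rules do not overlap and \<open>step\<close> determines its predecessors, so the
  \<open>THE\<close> in \<open>markovM\<close> picks the function given by any derivation.\<close>

lemma markov_val_unique:
  assumes "markov_val N f" "markov_val N g"
  shows "f = g"
  using assms
proof (induction arbitrary: g rule: markov_val.induct)
  case inf
  then show ?case
  proof (cases rule: markov_val.cases)
    case (step a b c d f' g' h')
    show ?thesis
      using farey_step_not_base[OF step(5) step(9) step(11)] unfolding step(1,2)[symmetric] by blast
  qed (simp_all only: prod.inject)
next
  case zero
  then show ?case
  proof (cases rule: markov_val.cases)
    case (step a b c d f' g' h')
    show ?thesis
      using farey_step_not_base[OF step(5) step(9) step(11)] unfolding step(1,2)[symmetric] by blast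
  qed (simp_all only: prod.inject)
next
  case one
  then show ?case
  proof (cases rule: markov_val.cases)
    case (step a b c d f' g' h')
    show ?thesis
      using farey_step_not_base[OF step(5) step(9) step(11)] unfolding step(1,2)[symmetric] by blast
  qed (simp_all only: prod.inject)
next
  case (step a b c d f g h k)
  note nb = farey_step_not_base[OF step.hyps(2) step.hyps(6) step.hyps(8)]
  from step.prems show ?case
  proof (cases rule: markov_val.cases)
    case prems: (step a' b' c' d' f' g' h')
    have "a = a' \<and> b = b' \<and> c = c' \<and> d = d'"
      by (rule farey_step_unique[OF step.hyps(6) prems(9)]) (use prems(1,2) step.hyps(7,8) in simp_all)
    then have "f = f'" "g = g'" "h = h'"
      using step.IH prems(6-8) by auto
    then show ?thesis unfolding prems(3) by (simp only:)
  qed (use nb in \<open>metis insertCI\<close>)+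
qed

lemma markovM_eqI:
  assumes "markov_val (a, b) f"
  shows "markovM a b = f"
  unfolding markovM_def using assms markov_val_unique by blast

section \<open>Markov triples\<close>

definition mmon :: "nat \<Rightarrow> nat \<Rightarrow> lfun" where
  "mmon p q u v w = u^p * v^q * w^(p+q)"

text \<open>The factor \<open>x * y * z\<close> stands in for exponents lowered by one, which would
  become negative in \<open>x\<close> for \<open>p = 0\<close>.\<close>

definition mval :: "nat \<Rightarrow> nat \<Rightarrow> lfun \<Rightarrow> lfun" where
  "mval p q F = restr (\<lambda>x y z. x * y * z * F (x^2) (y^2) (z^2) / mmon p q x y z)"

text \<open>\<open>wslice\<close> and \<open>vslice\<close> record \<open>F\<close> to first order in \<open>w\<close> on \<open>v = 1\<close> and in \<open>v\<close> on \<open>w = 1\<close>.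
  The factor \<open>(t+1)^2\<close> avoids negative exponents for small \<open>p\<close> and \<open>q\<close>; the exceptional
  cases are those where \<open>m\<close> itself has degree one in \<open>w\<close> or \<open>v\<close>.\<close>

definition wslice :: "nat \<Rightarrow> nat \<Rightarrow> lfun \<Rightarrow> bool" where
  "wslice p q F \<longleftrightarrow> (\<forall>t>0. F t 1 0 = (t+1)^(p+q-1) \<and>
     (\<exists>D. ((\<lambda>w. F t 1 w) has_real_derivative D) (at 0) \<and>
        D * (t+1)^2 = (if p = 0 then 0 else ((real q - 1) * t + (real p - 1)) * (t+1)^(p+q-1))))"

definition vslice :: "nat \<Rightarrow> nat \<Rightarrow> lfun \<Rightarrow> bool" where
  "vslice p q F \<longleftrightarrow> (\<forall>t>0. F t 0 1 = t^p * (t+1)^(q-1) \<and>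
     (\<exists>E. ((\<lambda>v. F t v 1) has_real_derivative E) (at 0) \<and>
        E * (t+1)^2 = (if q = 1 then real p * (t+1)^2
          else t^p * (t+1)^(q-1) * ((real p + real q - 1) * t + (3 * real p - 1)))))"

text \<open>With \<open>F1\<close> of index \<open>p/q\<close>, this is \<open>mmon p q\<close>
  times the other root of the Markov equation read as a quadratic in \<open>F2\<close>; the factor
  keeps it polynomial.\<close>

definition vieta :: "nat \<Rightarrow> nat \<Rightarrow> lfun \<Rightarrow> lfun \<Rightarrow> lfun \<Rightarrow> lfun" where
  "vieta p q F1 F2 F3 = (\<lambda>u v w. (u + v + w) * (F1 u v w * F3 u v w) - mmon p q u v w * F2 u v w)"

section \<open>First-order expansions under the Vieta step\<close>

lemma DERIV_mmon_w:
  assumes "1 \<le> p + q"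
  shows "((\<lambda>w. mmon p q t 1 w) has_real_derivative (if p + q = 1 then t^p else 0)) (at 0)"
  unfolding mmon_def using assms by (auto intro!: derivative_eq_intros)

lemma DERIV_mmon_v:
  assumes "1 \<le> q"
  shows "((\<lambda>v. mmon p q t v 1) has_real_derivative (if q = 1 then t^p else 0)) (at 0)"
  unfolding mmon_def using assms by (auto intro!: derivative_eq_intros)

text \<open>Away from the exceptional case the new function is \<open>(u+v+w) * F1 * F3\<close> to
  first order, so logarithmic derivatives add. Each of them is
  \<open>((q-1)*t + (p-1)) / (t+1)^2\<close>, and the summand \<open>1/(t+1)\<close> from
  \<open>u+v+w\<close> restores one of the two doubled -1 in each coefficient.\<close>

lemma wslice_vieta:
  assumes F: "wslice p q F1" "wslice r s F2" "wslice (p+r) (q+s) F3"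
    and "1 \<le> q" "1 \<le> s" "1 \<le> p + r" "p = 0 \<Longrightarrow> q = 1"
  shows "wslice (p + (p+r)) (q + (q+s)) (vieta p q F1 F2 F3)"
  unfolding wslice_def
proof (intro allI impI)
  fix t :: real assume t: "0 < t"
  obtain D1 where D1: "((\<lambda>w. F1 t 1 w) has_real_derivative D1) (at 0)"
     "D1 * (t+1)^2 = (if p = 0 then 0 else ((real q - 1) * t + (real p - 1)) * (t+1)^(p+q-1))"
     and F1: "F1 t 1 0 = (t+1)^(p+q-1)"
    using F(1) t unfolding wslice_def by blast
  obtain D2 where D2: "((\<lambda>w. F2 t 1 w) has_real_derivative D2) (at 0)"
     and F2: "F2 t 1 0 = (t+1)^(r+s-1)"
    using F(2) t unfolding wslice_def by blast
  obtain D3 where D3: "((\<lambda>w. F3 t 1 w) has_real_derivative D3) (at 0)"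
     "D3 * (t+1)^2 = ((real (q+s) - 1) * t + (real (p+r) - 1)) * (t+1)^(p+r+(q+s)-1)"
     and F3: "F3 t 1 0 = (t+1)^(p+r+(q+s)-1)"
    using F(3) t assms(6) unfolding wslice_def by (metis not_one_le_zero)
  define m where "m = p + q - 1"
  define k where "k = r + s - 1"
  have mk: "p + q - 1 = m" "r + s - 1 = k" "p + r + (q + s) - 1 = m + k + 1"
    "p + (p+r) + (q + (q+s)) - 1 = 2*m + k + 2"
    using assms(4,5) by (auto simp: m_def k_def)
  have m0: "mmon p q t 1 0 = 0" using assms(4) by (simp add: mmon_def)
  have pw: "(t+1)^(2*m+k+2) = (t+1) * ((t+1)^m * (t+1)^(m+k+1))"
  proof -
    have "2*m+k+2 = 1 + (m + (m+k+1))" by simp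
    then show ?thesis by (simp only: power_add power_one_right)
  qed
  let ?D = "F1 t 1 0 * F3 t 1 0 + (t + 1) * (D1 * F3 t 1 0 + F1 t 1 0 * D3)
      - (if p + q = 1 then t^p else 0) * F2 t 1 0"
  have "((\<lambda>w. vieta p q F1 F2 F3 t 1 w) has_real_derivative ?D) (at 0)"
    unfolding vieta_def
    by (rule derivative_eq_intros refl D1(1) D2 D3(1) DERIV_mmon_w | use assms(4) m0 in \<open>simp add: algebra_simps; fail\<close>)+
  moreover have "?D * (t+1)^2 = (if p + (p+r) = 0 then 0 else
      ((real (q + (q+s)) - 1) * t + (real (p + (p+r)) - 1)) * (t+1)^(p + (p+r) + (q + (q+s)) - 1))"
  proof (cases "p = 0")
    \<comment> \<open>For the neighbour \<open>0/1\<close> the derivative of \<open>F1\<close> is 0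
      instead of the general value; \<open>mmon p q\<close> is linear in \<open>w\<close>, and its
      product with \<open>F2\<close> supplies the missing -1.\<close>
    case True
    then have "m = 0" "D1 = 0" "q = 1" using assms(7) D1(2) t by (auto simp: m_def)
    then have "?D * (t+1)^2 = F3 t 1 0 * (t+1)^2 + (t+1) * (D3 * (t+1)^2) - F2 t 1 0 * (t+1)^2"
      using True F1 mk by (simp add: algebra_simps)
    also have "\<dots> = ((real s + 1) * t + (real r - 1)) * (t+1)^(k+2)"
      unfolding D3(2) F3 F2 mk using True \<open>m = 0\<close> \<open>q = 1\<close>
      by (simp add: algebra_simps power_add power2_eq_square)
    finally show ?thesis using True \<open>m = 0\<close> \<open>q = 1\<close> assms(6) unfolding mk by simp
  next
    case False
    then have "?D * (t+1)^2 = F1 t 1 0 * F3 t 1 0 * (t+1)^2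
        + (t+1) * ((D1 * (t+1)^2) * F3 t 1 0 + F1 t 1 0 * (D3 * (t+1)^2))"
      using assms(4) by (simp add: algebra_simps)
    also have "\<dots> = ((real (q + (q+s)) - 1) * t + (real (p + (p+r)) - 1)) * ((t+1) * ((t+1)^m * (t+1)^(m+k+1)))"
      unfolding D1(2) D3(2) F3 F1 mk using False
      by (simp add: algebra_simps power2_eq_square)
    finally show ?thesis using False unfolding mk pw by simp
  qed
  moreover have "vieta p q F1 F2 F3 t 1 0 = (t+1)^(p + (p+r) + (q + (q+s)) - 1)"
    unfolding vieta_def m0 F1 F3 mk pw by simp
  ultimately show "vieta p q F1 F2 F3 t 1 0 = (t+1)^(p + (p+r) + (q + (q+s)) - 1) \<and>
     (\<exists>D. ((\<lambda>w. vieta p q F1 F2 F3 t 1 w) has_real_derivative D) (at 0) \<and>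
        D * (t+1)^2 = (if p + (p+r) = 0 then 0 else
          ((real (q + (q+s)) - 1) * t + (real (p + (p+r)) - 1)) * (t+1)^(p + (p+r) + (q + (q+s)) - 1)))"
    by blast
qed

text \<open>Again logarithmic derivatives add, now of the form
  \<open>((p+q-1)*t + (3*p-1)) / (t+1)^2\<close>, with \<open>1/(t+1)\<close> contributed by
  \<open>u+v+w\<close>.\<close>

lemma vslice_vieta:
  assumes F: "vslice p q F1" "vslice r s F2" "vslice (p+r) (q+s) F3"
    and "1 \<le> q" "1 \<le> s" "p \<le> q"
  shows "vslice (p + (p+r)) (q + (q+s)) (vieta p q F1 F2 F3)"
  unfolding vslice_def
proof (intro allI impI)
  fix t :: real assume t: "0 < t"
  define m where "m = q - 1"
  define k where "k = s - 1"
  have mk: "q = m + 1" "s = k + 1"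
    using assms(4,5) by (auto simp: m_def k_def)
  obtain E1 where E1: "((\<lambda>v. F1 t v 1) has_real_derivative E1) (at 0)"
     "E1 * (t+1)^2 = (if q = 1 then real p * (t+1)^2
          else t^p * (t+1)^(q-1) * ((real p + real q - 1) * t + (3 * real p - 1)))"
     and F1: "F1 t 0 1 = t^p * (t+1)^m"
    using F(1) t unfolding vslice_def m_def by blast
  obtain E2 where E2: "((\<lambda>v. F2 t v 1) has_real_derivative E2) (at 0)"
     and F2: "F2 t 0 1 = t^r * (t+1)^k"
    using F(2) t unfolding vslice_def k_def by blast
  obtain E3 where E3: "((\<lambda>v. F3 t v 1) has_real_derivative E3) (at 0)"
     "E3 * (t+1)^2 = (if q + s = 1 then real (p + r) * (t+1)^2
          else t^(p+r) * (t+1)^(q+s-1) * ((real (p+r) + real (q+s) - 1) * t + (3 * real (p+r) - 1)))"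
     and F3: "F3 t 0 1 = t^(p+r) * (t+1)^(q+s-1)"
    using F(3) t unfolding vslice_def by blast
  have m0: "mmon p q t 0 1 = 0" using assms(4) by (simp add: mmon_def)
  let ?E = "F1 t 0 1 * F3 t 0 1 + (t + 1) * (E1 * F3 t 0 1 + F1 t 0 1 * E3)
      - (if q = 1 then t^p else 0) * F2 t 0 1"
  have D: "((\<lambda>v. vieta p q F1 F2 F3 t v 1) has_real_derivative ?E) (at 0)"
    unfolding vieta_def
    by (rule derivative_eq_intros refl E1(1) E2 E3(1) DERIV_mmon_v assms(4))+
      (simp add: m0 algebra_simps)
  define P R M K where "P = t^p" and "R = t^r" and "M = (t+1)^m" and "K = (t+1)^k"
  have "?E * (t+1)^2 = F1 t 0 1 * F3 t 0 1 * (t+1)^2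
      + (t+1) * ((E1 * (t+1)^2) * F3 t 0 1 + F1 t 0 1 * (E3 * (t+1)^2))
      - (if q = 1 then t^p else 0) * F2 t 0 1 * (t+1)^2"
    by (simp add: algebra_simps)
  also have "\<dots> = P * M * (P * R * (M * K * (t+1))) * (t+1)^2
      + (t+1) * ((if q = 1 then real p * (t+1)^2 else P * M * ((real p + real q - 1) * t + (3 * real p - 1)))
                 * (P * R * (M * K * (t+1)))
               + P * M * (P * R * (M * K * (t+1))
                 * ((real (p+r) + real (q+s) - 1) * t + (3 * real (p+r) - 1))))
      - (if q = 1 then P else 0) * (R * K) * (t+1)^2"
    unfolding E1(2) E3(2) F3 F1 F2 P_def R_def M_def K_def
    using mk by (simp add: power_add mult_ac)
  also have "\<dots> = P * (P * R) * (M * (M * K) * (t+1)^2) *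
      ((real (p+(p+r)) + real (q+(q+s)) - 1) * t + (3 * real (p+(p+r)) - 1))"
  proof -
    \<comment> \<open>For \<open>q = 1\<close> only \<open>0/1\<close> and \<open>1/1\<close> occur.
      There \<open>E1\<close> deviates from the general formula, and the term with
      \<open>F2\<close>, of first order in \<open>v\<close>, compensates exactly.\<close>
    consider "q = 1" "p = 0" "M = 1" "P = 1" | "q = 1" "p = 1" "M = 1" "P = t" | "q \<noteq> 1"
      using assms(6) mk(1) unfolding M_def P_def by (cases "q = 1"; cases "p = 0") (auto simp: le_Suc_eq)
    then show ?thesis
      by cases (simp_all add: algebra_simps power2_eq_square)
  qed
  also have "P * (P * R) * (M * (M * K) * (t+1)^2) = t^(p+(p+r)) * (t+1)^(q+(q+s)-1)"
    unfolding P_def R_def M_def K_def using mk by (simp add: power_add power2_eq_square mult_ac)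
  finally have "?E * (t+1)^2 = t^(p+(p+r)) * (t+1)^(q+(q+s)-1) *
      ((real (p+(p+r)) + real (q+(q+s)) - 1) * t + (3 * real (p+(p+r)) - 1))" .
  note D this
  moreover have "vieta p q F1 F2 F3 t 0 1 = t^(p+(p+r)) * (t+1)^(q + (q+s) - 1)"
    unfolding vieta_def m0 F1 F3 using mk by (simp add: power_add)
  moreover have "q + (q + s) \<noteq> 1" using assms(4) by simp
  ultimately show "vieta p q F1 F2 F3 t 0 1 = t^(p+(p+r)) * (t+1)^(q + (q+s) - 1) \<and>
     (\<exists>E. ((\<lambda>v. vieta p q F1 F2 F3 t v 1) has_real_derivative E) (at 0) \<and>
        E * (t+1)^2 = (if q+(q+s) = 1 then real (p+(p+r)) * (t+1)^2
          else t^(p+(p+r)) * (t+1)^(q+(q+s)-1) *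
            ((real (p+(p+r)) + real (q+(q+s)) - 1) * t + (3 * real (p+(p+r)) - 1))))"
    by auto
qed

section \<open>Numerators and Markov triples over Farey neighbours\<close>

definition markov_num :: "nat \<Rightarrow> nat \<Rightarrow> lfun \<Rightarrow> bool" where
  "markov_num p q F \<longleftrightarrow> 1 \<le> q \<and> p \<le> q \<and> coprime p q \<and> hom (p+q-1) F \<and>
     (\<forall>u>0. \<forall>v>0. \<forall>w>0. 0 < F u v w) \<and> wslice p q F \<and> vslice p q F \<and>
     markov_val (p, q) (mval p q F)"

text \<open>The last conjunct is
  \<open>M1^2 + M2^2 + M3^2 = (x^2+y^2+z^2)/(x*y*z) * M1*M2*M3\<close> in the variables
  \<open>u = x^2\<close>, \<open>v = y^2\<close>, \<open>w = z^2\<close>, with denominators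
  cleared.\<close>

definition markov_triple :: "nat \<Rightarrow> nat \<Rightarrow> nat \<Rightarrow> nat \<Rightarrow> lfun \<Rightarrow> lfun \<Rightarrow> lfun \<Rightarrow> bool" where
  "markov_triple p q r s F1 F2 F3 \<longleftrightarrow> \<bar>int p * int s - int q * int r\<bar> = 1 \<and>
     markov_num p q F1 \<and> markov_num r s F2 \<and> markov_num (p+r) (q+s) F3 \<and>
     (\<forall>u v w. (F1 u v w)^2 * mmon r s u v w + (F2 u v w)^2 * mmon p q u v w + (F3 u v w)^2
        = (u + v + w) * (F1 u v w * F2 u v w * F3 u v w))"

lemma markov_numD:
  assumes "markov_num p q F"
  shows "1 \<le> q" "p \<le> q" "coprime p q" "hom (p+q-1) F" "wslice p q F" "vslice p q F"
    "markov_val (p, q) (mval p q F)" "in_farey_set (p, q)"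
  using assms by (simp_all add: markov_num_def in_farey_set_def)

lemma markov_num_pos:
  "markov_num p q F \<Longrightarrow> 0 < u \<Longrightarrow> 0 < v \<Longrightarrow> 0 < w \<Longrightarrow> 0 < F u v w"
  by (simp add: markov_num_def)

lemma markov_triple_swap:
  "markov_triple p q r s F1 F2 F3 \<Longrightarrow> markov_triple r s p q F2 F1 F3"
  unfolding markov_triple_def
  by (simp add: add.commute mult.commute abs_minus_commute mult.left_commute)

lemma mmon_add: "mmon (p+r) (q+s) u v w = mmon p q u v w * mmon r s u v w"
  by (simp add: mmon_def power_add mult_ac)

lemma mmon_square: "mmon p q (x^2) (y^2) (z^2) = (mmon p q x y z)^2"
  by (simp only: mmon_def power_mult_distrib power_mult[symmetric] mult.commute[of 2])

lemma mmon_pos: "0 < u \<Longrightarrow> 0 < v \<Longrightarrow> 0 < w \<Longrightarrow> 0 < mmon p q u v w"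
  by (simp add: mmon_def)

lemma hom_mmon: "hom (p + q + (p + q)) (mmon p q)"
  using hom_monom[of p q "p+q" _ 1] by (simp add: mmon_def[abs_def] add.assoc)

lemma hom_vieta:
  assumes "hom (p+q-1) F1" "hom (r+s-1) F2" "hom (p+r+(q+s)-1) F3" "1 \<le> q" "1 \<le> s"
  shows "hom (p+(p+r)+(q+(q+s))-1) (vieta p q F1 F2 F3)"
proof -
  have lin: "hom 1 (\<lambda>u v w. u + v + w)"
    using hom_add[OF hom_add[OF hom_monom[of 1 0 0 1 1] hom_monom[of 0 1 0 1 1]] hom_monom[of 0 0 1 1 1]]
    by simp
  have "1 + (p+q-1 + (p+r+(q+s)-1)) = p+(p+r)+(q+(q+s))-1"
    "p + q + (p + q) + (r+s-1) = p+(p+r)+(q+(q+s))-1"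
    using assms(4,5) by auto
  from hom_diff[OF hom_mult[OF lin hom_mult[OF assms(1,3)], unfolded this(1)]
      hom_mult[OF hom_mmon assms(2), of p q, unfolded this(2)]]
  show ?thesis unfolding vieta_def .
qed

text \<open>The first identity is the exchange relation, that is, the product of the two roots;
  substituting it for \<open>F2 * F'\<close> yields the Markov equation of the new triple.\<close>

lemma vieta_eq:
  assumes "F1^2 * m2 + F2^2 * m1 + F3^2 = k * (F1 * F2 * F3)" and "F' = k * (F1 * F3) - m1 * F2"
  shows "F2 * F' = F1^2 * m2 + F3^2"
    and "F1^2 * (m1 * m2) + F3^2 * m1 + F'^2 = k * (F1 * F3 * (F'::real))"
proof -
  have "F2 * F' = k * (F1 * F2 * F3) - F2^2 * m1"
    unfolding assms(2) by (simp add: algebra_simps power2_eq_square)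
  then show 1: "F2 * F' = F1^2 * m2 + F3^2"
    unfolding assms(1)[symmetric] by simp
  have "F'^2 - k * (F1 * F3 * F') = - m1 * (F2 * F')"
    unfolding assms(2) by (simp add: algebra_simps power2_eq_square)
  then show "F1^2 * (m1 * m2) + F3^2 * m1 + F'^2 = k * (F1 * F3 * F')"
    unfolding 1 by (simp add: algebra_simps)
qed

text \<open>Replacing \<open>F2\<close> by the other root of the Markov equation, a quadratic in \<open>F2\<close>.\<close>

lemma markov_triple_vieta:
  assumes "markov_triple p q r s F1 F2 F3"
  shows "markov_triple p q (p+r) (q+s) F1 F3 (vieta p q F1 F2 F3)"
proof -
  let ?F = "vieta p q F1 F2 F3"
  have det: "\<bar>int p * int s - int q * int r\<bar> = 1"
    and n1: "markov_num p q F1" and n2: "markov_num r s F2" and n3: "markov_num (p+r) (q+s) F3"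
    and eq: "\<And>u v w. (F1 u v w)^2 * mmon r s u v w + (F2 u v w)^2 * mmon p q u v w + (F3 u v w)^2
        = (u + v + w) * (F1 u v w * F2 u v w * F3 u v w)"
    using assms unfolding markov_triple_def by blast+
  have v1: "F2 u v w * ?F u v w = (F1 u v w)^2 * mmon r s u v w + (F3 u v w)^2"
    and v2: "(F1 u v w)^2 * mmon (p+r) (q+s) u v w + (F3 u v w)^2 * mmon p q u v w + (?F u v w)^2
        = (u + v + w) * (F1 u v w * F3 u v w * ?F u v w)" for u v w
    unfolding mmon_add using vieta_eq[OF eq[of u v w], of "?F u v w"] by (simp_all only: vieta_def)
  have q: "1 \<le> q" "1 \<le> s" "p \<le> q" "r \<le> s" "p = 0 \<Longrightarrow> q = 1" "1 \<le> p + r"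
  proof -
    show "1 \<le> q" "1 \<le> s" "p \<le> q" "r \<le> s" "p = 0 \<Longrightarrow> q = 1"
      using n1 n2 by (auto simp: markov_num_def)
    show "1 \<le> p + r"
      using det by (cases "p = 0"; cases "r = 0") auto
  qed
  have pos: "0 < F1 u v w" "0 < F2 u v w" "0 < F3 u v w" if "0 < u" "0 < v" "0 < w" for u v w
    using n1 n2 n3 that by (simp_all add: markov_num_pos)
  \<comment> \<open>The recursion contains a minus sign, so positivity is taken from the exchange
    relation, whose right side is a sum of positive terms.\<close>
  have pos': "0 < ?F u v w" if "0 < u" "0 < v" "0 < w" for u v w
  proof -
    have "0 < (F1 u v w)^2 * mmon r s u v w + (F3 u v w)^2"
      using pos[OF that] mmon_pos[OF that] by (intro add_pos_pos mult_pos_pos) auto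
    then have "0 < F2 u v w * ?F u v w" using v1 by simp
    then show ?thesis using pos(2)[OF that] by (simp add: zero_less_mult_iff)
  qed
  have cop: "coprime (p+(p+r)) (q+(q+s))"
  proof -
    have "coprime (int (p+(p+r))) (int (q+(q+s)))"
    proof (rule coprimeI)
      fix k assume "k dvd int (p+(p+r))" "k dvd int (q+(q+s))"
      then have "k dvd int p * int (q+(q+s)) - int q * int (p+(p+r))" by simp
      also have "int p * int (q+(q+s)) - int q * int (p+(p+r)) = int p * int s - int q * int r"
        by (simp add: algebra_simps)
      finally show "is_unit k" using det by (metis dvd_abs_iff)
    qed
    then show ?thesis by (simp only: coprime_int_iff)
  qed
  have val: "markov_val (p+(p+r), q+(q+s)) (mval (p+(p+r)) (q+(q+s)) ?F)"
  proof -
    let ?g = "mval p q F1" and ?f = "mval r s F2" and ?h = "mval (p+r) (q+s) F3"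
    \<comment> \<open>In the defining rule \<open>p/q\<close> plays the role of \<open>c/d\<close>,
      and \<open>r/s\<close> is the fraction \<open>a/b\<close> whose function is divided
      by.\<close>
    have "markov_val (r + 2*p, s + 2*q) (restr (\<lambda>x y z. ((?g x y z)^2 + (?h x y z)^2) / ?f x y z))"
    proof (rule markov_val.step)
      show "in_farey_set (r, s)" "in_farey_set (p, q)"
        by (rule markov_numD n1 n2)+
      show "markov_val (r, s) ?f" "markov_val (p, q) ?g" "markov_val (r+p, s+q) ?h"
        unfolding add.commute[of r p] add.commute[of s q] by (rule markov_numD n1 n2 n3)+
      show "\<bar>int r * int q - int s * int p\<bar> = 1"
        using det by (simp add: mult.commute abs_minus_commute)
    qed (use q in auto)
    also have "restr (\<lambda>x y z. ((?g x y z)^2 + (?h x y z)^2) / ?f x y z) = mval (p+(p+r)) (q+(q+s)) ?F"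
    proof (intro ext)
      fix x y z
      show "restr (\<lambda>x y z. ((?g x y z)^2 + (?h x y z)^2) / ?f x y z) x y z = mval (p+(p+r)) (q+(q+s)) ?F x y z"
      proof (cases "0 < x \<and> 0 < y \<and> 0 < z")
        case True
        then have p2: "0 < x^2" "0 < y^2" "0 < z^2" by auto
        define m1 where "m1 = mmon p q x y z"
        define m2 where "m2 = mmon r s x y z"
        define k where "k = x * y * z"
        define f1 where "f1 = F1 (x^2) (y^2) (z^2)"
        define f2 where "f2 = F2 (x^2) (y^2) (z^2)"
        define f3 where "f3 = F3 (x^2) (y^2) (z^2)"
        define f where "f = ?F (x^2) (y^2) (z^2)"
        have ne: "m1 \<noteq> 0" "m2 \<noteq> 0" "k \<noteq> 0" "f2 \<noteq> 0"
          using True mmon_pos[of x y z p q] mmon_pos[of x y z r s] pos(2)[OF p2]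
          by (auto simp: m1_def m2_def k_def f2_def)
        have ff: "f1^2 * m2^2 + f3^2 = f2 * f"
          using v1[of "x^2" "y^2" "z^2"] by (simp add: f_def f1_def f2_def f3_def m2_def mmon_square)
        have "(k * f1 / m1)^2 + (k * f3 / (m1 * m2))^2 = (k / (m1 * m2))^2 * (f1^2 * m2^2 + f3^2)"
          using ne by (simp add: power_divide power_mult_distrib distrib_left)
        then have "((k * f1 / m1)^2 + (k * f3 / (m1 * m2))^2) / (k * f2 / m2) = k * f / (m1 * (m1 * m2))"
          unfolding ff using ne by (simp add: power2_eq_square)
        then show ?thesis
          using True by (simp add: mval_def restr_def mmon_add m1_def m2_def k_def f_def f1_def f2_def f3_def)
      qed (auto simp: mval_def restr_def)
    qed
    finally show ?thesis
      by (simp only: mult_2 add_ac)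
  qed
  have "markov_num (p+(p+r)) (q+(q+s)) ?F"
    unfolding markov_num_def
  proof (intro conjI allI impI)
    show "hom (p+(p+r)+(q+(q+s))-1) ?F"
      by (intro hom_vieta q markov_numD n1 n2 n3)
    show "wslice (p+(p+r)) (q+(q+s)) ?F"
      by (intro wslice_vieta q markov_numD n1 n2 n3)
    show "vslice (p+(p+r)) (q+(q+s)) ?F"
      by (intro vslice_vieta q markov_numD n1 n2 n3)
  qed (use q cop pos' val in simp_all)
  moreover have "\<bar>int p * int (q+s) - int q * int (p+r)\<bar> = 1"
    using det by (simp add: algebra_simps)
  ultimately show ?thesis
    unfolding markov_triple_def using n1 n3 v2 by blast
qed

text \<open>The tree is rooted at \<open>0/1\<close>, \<open>1/1\<close>, \<open>1/2\<close>,
  because \<open>1/0\<close> violates \<open>1 \<le> q\<close> in \<open>markov_num\<close>. It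
  enters only through the single step that produces the function for \<open>1/2\<close>.\<close>

lemma markov_triple_root:
  "markov_triple 0 1 1 1 (\<lambda>u v w. 1) (\<lambda>u v w. u + v) (\<lambda>u v w. u * w + (u + v)^2)"
proof -
  have v0: "mval 0 1 (\<lambda>u v w. 1) = restr (\<lambda>x y z. x)"
    by (auto simp: mval_def restr_def mmon_def fun_eq_iff)
  have v1: "mval 1 1 (\<lambda>u v w. u + v) = restr (\<lambda>x y z. (x^2 + y^2) / z)"
    by (auto simp: mval_def restr_def mmon_def fun_eq_iff power2_eq_square)
  have n0: "markov_num 0 1 (\<lambda>u v w. 1)"
    unfolding markov_num_def wslice_def vslice_def v0
    using hom_monom[of 0 0 0 0 1] markov_val.zero
    by (auto intro!: exI[of _ 0])
  have n1: "markov_num 1 1 (\<lambda>u v w. u + v)"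
    unfolding markov_num_def wslice_def vslice_def v1 power2_eq_square
    using hom_add[OF hom_monom[of 1 0 0 1 1] hom_monom[of 0 1 0 1 1]] markov_val.one[unfolded power2_eq_square]
    by (auto intro!: exI[of _ 0] exI[of _ 1] derivative_eq_intros)
  have "markov_val (1 + 2*0, 0 + 2*1) (restr (\<lambda>x y z. ((restr (\<lambda>x y z. x) x y z)^2
      + (restr (\<lambda>x y z. (x^2 + y^2) / z) x y z)^2) / restr (\<lambda>x y z. y) x y z))"
    by (rule markov_val.step) (auto simp: in_farey_set_def intro: markov_val.intros[simplified])
  also have "restr (\<lambda>x y z. ((restr (\<lambda>x y z. x) x y z)^2
      + (restr (\<lambda>x y z. (x^2 + y^2) / z) x y z)^2) / restr (\<lambda>x y z. y) x y z)
      = mval 1 2 (\<lambda>u v w. u * w + (u + v)^2)"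
    by (auto simp: mval_def restr_def mmon_def fun_eq_iff field_simps power2_eq_square eval_nat_numeral)
  finally have val: "markov_val (1, 2) (mval 1 2 (\<lambda>u v w. u * w + (u + v)^2))"
    by (simp add: numeral_2_eq_2)
  have "hom 2 (\<lambda>u v w. u * w + (u + v)^2)"
  proof -
    have "hom 1 (\<lambda>u v w. u + v)"
      using n1 by (simp add: markov_num_def)
    from hom_mult[OF this this] have "hom 2 (\<lambda>u v w. (u + v)^2)"
      by (simp add: power2_eq_square numeral_2_eq_2)
    from hom_add[OF hom_monom[of 1 0 1 2 1] this] show ?thesis by simp
  qed
  moreover have "wslice 1 2 (\<lambda>u v w. u * w + (u + v)^2)"
    unfolding wslice_def
    by (auto intro!: exI derivative_eq_intros simp: power2_eq_square)
  moreover have "vslice 1 2 (\<lambda>u v w. u * w + (u + v)^2)"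
    unfolding vslice_def
    by (auto intro!: exI derivative_eq_intros simp: algebra_simps power2_eq_square)
  ultimately have "markov_num 1 2 (\<lambda>u v w. u * w + (u + v)^2)"
    unfolding markov_num_def using val by (auto simp: add_pos_pos numeral_2_eq_2)
  then show ?thesis
    unfolding markov_triple_def using n0 n1
    by (auto simp: mmon_def numeral_2_eq_2 algebra_simps)
qed

section \<open>Reaching every reduced fraction from the root triple\<close>

text \<open>Stern-Brocot descent: of two neighbours, the one with the larger denominator is the
  mediant of the other and an earlier fraction. Subtracting lowers \<open>q + s\<close>, and one
  Vieta step leads back up.\<close>

lemma markov_triple_exists:
  assumes "q * r = p * s + 1" "1 \<le> q" "1 \<le> s" "p \<le> q" "r \<le> s"
  shows "\<exists>F1 F2 F3. markov_triple p q r s F1 F2 F3"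
  using assms
proof (induction "q + s" arbitrary: p q r s rule: less_induct)
  case less
  have r: "1 \<le> r" using less.prems by (cases r) auto
  consider "q < s" | "s < q" | "q = s" by linarith
  then show ?case
  proof cases
    case 1
    obtain s' where s: "s = q + s'" using 1 less_imp_add_positive by blast
    have "1 \<le> s'" using 1 s by simp
    have "p < r"
    proof (rule ccontr)
      assume "\<not> p < r"
      then have "q * r \<le> s * p" using 1 by (intro mult_mono) auto
      then show False using less.prems(1) by (simp add: mult.commute)
    qed
    then obtain r' where r': "r = p + r'" by (metis less_imp_add_positive)
    have det: "q * r' = p * s' + 1" using less.prems(1) unfolding s r' by (simp add: algebra_simps)
    \<comment> \<open>The earlier fraction must stay in \<open>[0,1]\<close>. Otherwise the
      determinant equation forces \<open>q = 1\<close>, and both \<open>p = 0\<close> and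
      \<open>p = 1\<close> are then impossible.\<close>
    have "r' \<le> s'"
    proof (rule ccontr)
      assume "\<not> r' \<le> s'"
      then have "q * (s' + 1) \<le> q * r'" by (intro mult_left_mono) auto
      also have "\<dots> \<le> q * s' + 1" unfolding det using less.prems(4) by (simp add: mult_right_mono)
      finally have "q = 1" using less.prems(2) by (simp add: algebra_simps)
      then show False using det \<open>q = 1\<close> \<open>\<not> r' \<le> s'\<close> less.prems(5) s r' \<open>1 \<le> s'\<close> less.prems(4)
        by (cases "p = 0") auto
    qed
    then obtain F1 F2 F3 where *: "markov_triple p q r' s' F1 F2 F3"
      using less.hyps[of q s' r' p] det s \<open>1 \<le> s'\<close> less.prems(2,4) by auto
    from markov_triple_vieta[OF *] show ?thesis unfolding s r' by blast
  next
    case 2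
    obtain q' where q: "q = s + q'" using 2 less_imp_add_positive by blast
    have "1 \<le> q'" using 2 q by simp
    have "r \<le> p"
    proof (rule ccontr)
      assume "\<not> r \<le> p"
      then have "s * p + s \<le> s * r" by (metis add.commute mult_Suc_right mult_le_mono2 not_less_eq_eq)
      moreover have "q * r = s * r + q' * r" unfolding q by (simp add: algebra_simps)
      moreover have "1 \<le> q' * r" using \<open>1 \<le> q'\<close> r by simp
      ultimately show False using less.prems by (simp add: mult.commute)
    qed
    then obtain p' where p': "p = r + p'" by (metis le_iff_add)
    have det: "q' * r = p' * s + 1" using less.prems(1) unfolding q p' by (simp add: algebra_simps)
    have "p' \<le> q'"
    proof (rule ccontr)
      assume "\<not> p' \<le> q'"
      then have "q' * r \<le> p' * s" using less.prems(5) by (intro mult_mono) auto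
      then show False using det by simp
    qed
    then obtain F1 F2 F3 where "markov_triple p' q' r s F1 F2 F3"
      using less.hyps[of q' s r p'] det q \<open>1 \<le> q'\<close> less.prems(3,5) by auto
    \<comment> \<open>The Vieta step keeps the first fraction, and here \<open>r/s\<close> is the
      one to keep, hence the swaps.\<close>
    from markov_triple_vieta[OF markov_triple_swap[OF this]]
    have "markov_triple r s p q F2 F3 (vieta r s F2 F1 F3)"
      by (simp add: p' q add.commute)
    from markov_triple_swap[OF this] show ?thesis by blast
  next
    case 3
    \<comment> \<open>Equal denominators give \<open>q * (r - p) = 1\<close>, which is the
      root.\<close>
    have "p < r"
    proof (rule ccontr)
      assume "\<not> p < r"
      then have "q * r \<le> p * q" by (simp add: mult.commute)
      then show False using less.prems(1) unfolding 3[symmetric] by linarith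
    qed
    then obtain k where "r = p + k" by (metis less_imp_add_positive)
    then have "q * k = 1" using less.prems(1) 3 by (simp add: algebra_simps)
    then have "q = 1" "k = 1" by auto
    then have "p = 0" "r = 1" "s = 1" using 3 less.prems \<open>r = p + k\<close> by auto
    then show ?thesis using \<open>q = 1\<close> markov_triple_root by blast
  qed
qed

text \<open>For \<open>b > 1\<close>, \<open>a/b\<close> is the mediant of its Farey parents
  \<open>p/q\<close> and \<open>r/s\<close>, so its numerator is the third entry of their
  triple.\<close>

lemma markov_num_exists:
  assumes "1 \<le> a" "a \<le> b" "coprime a b"
  shows "\<exists>F. markov_num a b F"
proof (cases "b = 1")
  case True
  then show ?thesis using assms markov_triple_root unfolding markov_triple_def by auto
next
  case False
  then have "a < b" using assms by (cases "a = b") auto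
  obtain q p where qp: "a * q = b * p + 1" "q < b"
  proof -
    obtain x y where "a * x = b * y + gcd a b"
      using bezout_nat[of a b] assms(1) by auto
    then have 1: "a * x = b * y + 1" using assms(3) by simp
    \<comment> \<open>The denominator \<open>q\<close> of the left parent is the inverse of
      \<open>a\<close> modulo \<open>b\<close>, reduced below \<open>b\<close>.\<close>
    have "a * (x mod b) mod b = 1"
      unfolding mod_mult_right_eq 1 mod_mult_self4 using False assms(1,2) by simp
    then have "a * (x mod b) = b * (a * (x mod b) div b) + 1"
      by (metis mult_div_mod_eq)
    then show thesis using that assms(1,2) by simp
  qed
  have q0: "1 \<le> q" using qp by (cases q) auto
  have "p < q"
  proof (rule ccontr)
    assume "\<not> p < q"
    then have "a * q \<le> b * p" using assms(2) by (intro mult_mono) auto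
    then show False using qp by simp
  qed
  have "p \<le> a"
  proof (rule ccontr)
    assume "\<not> p \<le> a"
    then have "q * a \<le> b * p" using qp(2) by (intro mult_mono) auto
    then show False using qp by (simp add: mult.commute)
  qed
  then obtain r where r: "a = p + r" by (metis le_iff_add)
  obtain s where s: "b = q + s" using qp(2) less_imp_add_positive by blast
  have s1: "1 \<le> s" using qp(2) s by simp
  have det: "q * r = p * s + 1" using qp(1) unfolding r s by (simp add: algebra_simps)
  have "r \<le> s"
  proof (rule ccontr)
    assume "\<not> r \<le> s"
    then have "b * (s + 1) \<le> b * r" by (intro mult_left_mono) auto
    also have "b * r = a * s + 1" using det unfolding r s by (simp add: algebra_simps)
    also have "\<dots> \<le> (b - 1) * s + 1" using \<open>a < b\<close> by (intro add_right_mono mult_right_mono) auto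
    finally have "b * s + b \<le> (b - 1) * s + 1" by simp
    moreover have "(b - 1) * s \<le> b * s" by (intro mult_right_mono) auto
    ultimately show False using False assms(1,2) by linarith
  qed
  then obtain F1 F2 F3 where "markov_triple p q r s F1 F2 F3"
    using markov_triple_exists[OF det q0 s1] \<open>p < q\<close> by auto
  then show ?thesis unfolding markov_triple_def r s by blast
qed

section \<open>Log-concave sequences\<close>

text \<open>The middle condition rules out internal zeros; with it, log-concavity survives
  multiplication of the generating function by a linear factor.\<close>

definition slc :: "(int \<Rightarrow> real) \<Rightarrow> bool" where
  "slc x \<longleftrightarrow> (\<forall>k. 0 \<le> x k) \<and> (\<forall>i j. i \<le> j \<longrightarrow> x (i-1) * x (j+1) \<le> x i * x j) \<and>
     (\<forall>k. 0 < x k \<longrightarrow> x (k-1) * x (k+1) < (x k)^2)"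

lemma slcD:
  assumes "slc x"
  shows "0 \<le> x k" "i \<le> j \<Longrightarrow> x (i-1) * x (j+1) \<le> x i * x j"
    "0 < x k \<Longrightarrow> x (k-1) * x (k+1) < (x k)^2"
  using assms unfolding slc_def by blast+

lemma slc_shift:
  assumes "slc x"
  shows "slc (\<lambda>k. x (k - s))"
  unfolding slc_def
proof (intro conjI allI impI)
  fix i j k :: int
  show "0 \<le> x (k - s)" using slcD(1)[OF assms] .
  show "x (i - 1 - s) * x (j + 1 - s) \<le> x (i - s) * x (j - s)" if "i \<le> j"
    using slcD(2)[OF assms, of "i - s" "j - s"] that by (simp add: algebra_simps)
  show "x (k - 1 - s) * x (k + 1 - s) < (x (k - s))^2" if "0 < x (k - s)"
    using slcD(3)[OF assms that] by (simp add: algebra_simps)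
qed

text \<open>The difference of the two products splits into parts with factors
  \<open>\<alpha>^2\<close>, \<open>\<beta>^2\<close> and \<open>\<alpha> * \<beta>\<close>. Each is
  nonnegative, and strictness comes from one of the square parts.\<close>

lemma slc_linear:
  assumes x: "slc x" and nn: "0 \<le> \<alpha>" "0 \<le> \<beta>"
  shows "slc (\<lambda>k. \<alpha> * x k + \<beta> * x (k-1))"
  unfolding slc_def
proof (intro conjI allI impI)
  fix i j k :: int
  show nonneg: "0 \<le> \<alpha> * x k + \<beta> * x (k-1)" for k
    using slcD(1)[OF x] nn by simp
  \<comment> \<open>This bounds the mixed part, where two of the four products cancel. Two inward
    moves prove it; for \<open>i = j\<close> one move suffices, as the right side is then
    symmetric.\<close>
  have cross: "x (i-2) * x (j+1) \<le> x i * x (j-1)" if "i \<le> j" for i j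
  proof (cases "i = j")
    case True
    then show ?thesis using slcD(2)[OF x, of "i-1" "i"] by (simp add: mult.commute)
  next
    case False
    then have "x (i-1) * x (j-1+1) \<le> x i * x (j-1)"
      using that by (intro slcD(2)[OF x]) simp
    moreover have "x (i-1-1) * x (j+1) \<le> x (i-1) * x j"
      using that by (intro slcD(2)[OF x]) simp
    ultimately show ?thesis by simp
  qed
  have expand: "(\<alpha> * x i + \<beta> * x (i-1)) * (\<alpha> * x j + \<beta> * x (j-1))
      - (\<alpha> * x (i-1) + \<beta> * x (i-1-1)) * (\<alpha> * x (j+1) + \<beta> * x (j+1-1))
      = \<alpha>^2 * (x i * x j - x (i-1) * x (j+1))
      + \<beta>^2 * (x (i-1) * x (j-1) - x (i-1-1) * x (j-1+1))
      + \<alpha> * \<beta> * (x i * x (j-1) - x (i-2) * x (j+1))" for i j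
    by (simp add: algebra_simps power2_eq_square)
  show "(\<alpha> * x (i-1) + \<beta> * x (i-1-1)) * (\<alpha> * x (j+1) + \<beta> * x (j+1-1))
      \<le> (\<alpha> * x i + \<beta> * x (i-1)) * (\<alpha> * x j + \<beta> * x (j-1))" if "i \<le> j"
  proof -
    have "0 \<le> \<alpha>^2 * (x i * x j - x (i-1) * x (j+1))"
      "0 \<le> \<beta>^2 * (x (i-1) * x (j-1) - x (i-1-1) * x (j-1+1))"
      "0 \<le> \<alpha> * \<beta> * (x i * x (j-1) - x (i-2) * x (j+1))"
      using nn slcD(2)[OF x, of i j] slcD(2)[OF x, of "i-1" "j-1"] cross[of i j] that by simp_all
    with expand[of i j] show ?thesis by linarith
  qed
  show "(\<alpha> * x (k-1) + \<beta> * x (k-1-1)) * (\<alpha> * x (k+1) + \<beta> * x (k+1-1))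
      < (\<alpha> * x k + \<beta> * x (k-1))^2" if "0 < \<alpha> * x k + \<beta> * x (k-1)"
  proof -
    have 1: "0 \<le> \<alpha>^2 * (x k * x k - x (k-1) * x (k+1))"
      "0 \<le> \<beta>^2 * (x (k-1) * x (k-1) - x (k-1-1) * x (k-1+1))"
      "0 \<le> \<alpha> * \<beta> * (x k * x (k-1) - x (k-2) * x (k+1))"
      using nn slcD(2)[OF x, of k k] slcD(2)[OF x, of "k-1" "k-1"] cross[of k k] by simp_all
    have "0 < \<alpha> * x k \<or> 0 < \<beta> * x (k-1)" using that by linarith
    then consider "0 < \<alpha>" "0 < x k" | "0 < \<beta>" "0 < x (k-1)"
      using nn slcD(1)[OF x] by (auto simp: zero_less_mult_iff not_less[symmetric])
    then have "0 < \<alpha>^2 * (x k * x k - x (k-1) * x (k+1))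
        \<or> 0 < \<beta>^2 * (x (k-1) * x (k-1) - x (k-1-1) * x (k-1+1))"
      using slcD(3)[OF x, of k] slcD(3)[OF x, of "k-1"] by cases (simp_all add: power2_eq_square)
    with 1 expand[of k k] show ?thesis unfolding power2_eq_square by linarith
  qed
qed

text \<open>Extending by zero to negative \<open>k\<close> makes Pascal's rule valid for all
  integers and provides neighbours at the ends of a row.\<close>

definition ibinom :: "nat \<Rightarrow> int \<Rightarrow> real" where
  "ibinom m k = (if k < 0 then 0 else real (m choose nat k))"

lemma ibinom_Suc: "ibinom (Suc m) k = ibinom m k + ibinom m (k - 1)"
proof (cases "0 < k")
  case True
  then have "nat k = Suc (nat (k - 1))" by simp
  with True show ?thesis by (simp add: ibinom_def)
next
  case False
  then show ?thesis by (cases "k = 0") (simp_all add: ibinom_def)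
qed

lemma ibinom_pos: "0 \<le> k \<Longrightarrow> k \<le> int m \<Longrightarrow> 0 < ibinom m k"
  by (simp add: ibinom_def)

lemma ibinom_eq_0: "k < 0 \<or> int m < k \<Longrightarrow> ibinom m k = 0"
  by (auto simp: ibinom_def binomial_eq_0)

lemma slc_ibinom: "slc (ibinom m)"
proof (induction m)
  case 0
  have "ibinom 0 k = (if k = 0 then 1 else 0)" for k
    by (simp add: ibinom_def)
  then show ?case by (auto simp: slc_def)
next
  case (Suc m)
  have "ibinom (Suc m) = (\<lambda>k. 1 * ibinom m k + 1 * ibinom m (k-1))"
    by (simp add: ibinom_Suc fun_eq_iff)
  then show ?case using slc_linear[OF Suc, of 1 1] by simp
qed

text \<open>An index shift multiplies the generating function by a power of \<open>t\<close>; the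
  hypothesis makes the first \<open>s\<close> coefficients vanish.\<close>

lemma sum_shift:
  fixes f :: "int \<Rightarrow> real"
  assumes "\<And>k. k < 0 \<Longrightarrow> f k = 0"
  shows "(\<Sum>i\<le>s+N. f (int i - int s) * t^i) = t^s * (\<Sum>i\<le>N. f (int i) * t^i)"
proof (induction s)
  case (Suc s)
  have "(\<Sum>i\<le>Suc s + N. f (int i - int (Suc s)) * t^i) = (\<Sum>i\<le>s+N. f (int i - int s) * t^Suc i)"
    using assms[of "- int (Suc s)"] by (simp add: sum.atMost_Suc_shift del: sum.atMost_Suc)
  also have "\<dots> = t * (\<Sum>i\<le>s+N. f (int i - int s) * t^i)"
    by (simp add: sum_distrib_left mult_ac)
  finally show ?case unfolding Suc by simp
qed simp

lemma sum_linear_ibinom: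
  fixes t :: real
  shows "(\<Sum>i\<le>Suc m. (\<alpha> * ibinom m (int i) + \<beta> * ibinom m (int i - 1)) * t^i) = (\<alpha> + \<beta> * t) * (t+1)^m"
proof -
  have "(\<Sum>i\<le>m. ibinom m (int i) * t^i) = (t+1)^m"
    by (simp add: ibinom_def binomial_ring)
  moreover have "(\<Sum>i\<le>Suc m. ibinom m (int i - 1) * t^i) = t * (\<Sum>i\<le>m. ibinom m (int i) * t^i)"
    using sum_shift[where f = "ibinom m" and s = 1 and N = m] by (simp add: ibinom_eq_0 del: sum.atMost_Suc)
  moreover have "(\<Sum>i\<le>Suc m. ibinom m (int i) * t^i) = (\<Sum>i\<le>m. ibinom m (int i) * t^i)"
    using ibinom_eq_0[of "int (Suc m)" m] by simp
  moreover have "(\<Sum>i\<le>Suc m. (\<alpha> * ibinom m (int i) + \<beta> * ibinom m (int i - 1)) * t^i)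
      = \<alpha> * (\<Sum>i\<le>Suc m. ibinom m (int i) * t^i) + \<beta> * (\<Sum>i\<le>Suc m. ibinom m (int i - 1) * t^i)"
    by (simp only: distrib_right sum.distrib sum_distrib_left mult.assoc)
  ultimately show ?thesis by (simp add: algebra_simps del: sum.atMost_Suc)
qed

section \<open>Coefficients on the two lines\<close>

lemma is_markovPD:
  assumes "is_markovP a b A"
  shows "A i j \<noteq> 0 \<Longrightarrow> 0 \<le> i \<and> 0 \<le> j \<and> i + j \<le> int (a + b - 1)"
    and "0 < x \<Longrightarrow> 0 < y \<Longrightarrow> 0 < z \<Longrightarrow> markovM a b x y z =
      (\<Sum>i\<le>a+b-1. \<Sum>j\<le>a+b-1-i. A (int i) (int j) * (x^2)^i * (y^2)^j * (z^2)^(a+b-1-i-j))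
        / (x^(a-1) * y^(b-1) * z^(a+b-1))"
  using assms unfolding is_markovP_def by blast+

text \<open>This justifies the \<open>THE\<close> in \<open>markovA\<close>. Square roots turn every
  positive \<open>(u, v, w)\<close> into \<open>(x^2, y^2, z^2)\<close>, and outside the triangle
  both families are 0.\<close>

lemma is_markovP_unique:
  assumes "is_markovP a b A" "is_markovP a b B"
  shows "A = B"
proof (intro ext)
  fix i j
  let ?n = "a + b - 1"
  show "A i j = B i j"
  proof (cases "0 \<le> i \<and> 0 \<le> j \<and> i + j \<le> int ?n")
    case True
    have "A (int (nat i)) (int (nat j)) = B (int (nat i)) (int (nat j))"
    proof (rule homogeneous_coeffs_unique[where n = ?n])
      fix u v w :: real assume pos: "0 < u" "0 < v" "0 < w"
      define x y z where "x = sqrt u" and "y = sqrt v" and "z = sqrt w"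
      have xyz: "0 < x" "0 < y" "0 < z" "x^2 = u" "y^2 = v" "z^2 = w"
        using pos by (simp_all add: x_def y_def z_def)
      then have "x^(a-1) * y^(b-1) * z^?n \<noteq> 0" by simp
      moreover have "(\<Sum>i\<le>?n. \<Sum>j\<le>?n-i. A (int i) (int j) * u^i * v^j * w^(?n-i-j)) / (x^(a-1) * y^(b-1) * z^?n)
        = (\<Sum>i\<le>?n. \<Sum>j\<le>?n-i. B (int i) (int j) * u^i * v^j * w^(?n-i-j)) / (x^(a-1) * y^(b-1) * z^?n)"
        using is_markovPD(2)[OF assms(1) xyz(1-3)] is_markovPD(2)[OF assms(2) xyz(1-3)]
        unfolding xyz(4-6) by (rule trans[OF sym])
      ultimately show "(\<Sum>i\<le>?n. \<Sum>j\<le>?n-i. A (int i) (int j) * u^i * v^j * w^(?n-i-j))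
        = (\<Sum>i\<le>?n. \<Sum>j\<le>?n-i. B (int i) (int j) * u^i * v^j * w^(?n-i-j))"
        by (simp only: divide_cancel_right simp_thms)
    qed (use True in auto)
    then show ?thesis using True by simp
  next
    case False
    then show ?thesis using is_markovPD(1)[OF assms(1)] is_markovPD(1)[OF assms(2)] by metis
  qed
qed

text \<open>Each derivative of the numerator is computed twice, from its coefficients and from the
  slices; uniqueness of derivatives equates the results.\<close>

lemma markovA_lines:
  fixes a b :: nat
  assumes ab: "1 \<le> a" "a \<le> b" "coprime a b"
  defines "n \<equiv> a + b - 1"
  shows "\<And>i j. \<not> (0 \<le> i \<and> 0 \<le> j \<and> i + j \<le> int n) \<Longrightarrow> markovA a b i j = 0"
    and "\<And>t. 0 < t \<Longrightarrow> (\<Sum>i<n. markovA a b (int i) (int (n-1-i)) * t^i) * (t+1)^2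
      = ((real b - 1) * t + (real a - 1)) * (t+1)^n"
    and "\<And>t. 0 < t \<Longrightarrow> (\<Sum>i<n. markovA a b (int i) 1 * t^i) * (t+1)^2
      = (if b = 1 then real a * (t+1)^2
         else t^a * (t+1)^(b-1) * ((real a + real b - 1) * t + (3 * real a - 1)))"
proof -
  obtain F where F: "markov_num a b F" using markov_num_exists[OF ab] by blast
  obtain A where A: "\<And>u v w. F u v w = (\<Sum>i\<le>n. \<Sum>j\<le>n-i. A i j * u^i * v^j * w^(n-i-j))"
    using hom_coeffs[OF markov_numD(4)[OF F]] unfolding n_def by blast
  define B where "B i j = (if 0 \<le> i \<and> 0 \<le> j \<and> i + j \<le> int n then A (nat i) (nat j) else 0)" for i j
  have BA: "B (int i) (int j) = A i j" if "i \<le> n" "j \<le> n - i" for i j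
  proof -
    have "int i + int j \<le> int n" using that by linarith
    then show ?thesis by (simp add: B_def)
  qed
  have "is_markovP a b B"
    unfolding is_markovP_def n_def[symmetric]
  proof (intro conjI allI impI)
    fix x y z :: real assume pos: "0 < x" "0 < y" "0 < z"
    have pw: "x^a = x * x^(a-1)" "y^b = y * y^(b-1)" "z^(a+b) = z * z^n"
      using ab by (simp_all add: n_def power_eq_if)
    have "markovM a b x y z = mval a b F x y z"
      using markovM_eqI[OF markov_numD(7)[OF F]] by simp
    also have "\<dots> = F (x^2) (y^2) (z^2) / (x^(a-1) * y^(b-1) * z^n)"
      using pos by (simp add: mval_def restr_def mmon_def pw)
    also have "F (x^2) (y^2) (z^2) = (\<Sum>i\<le>n. \<Sum>j\<le>n-i. B (int i) (int j) * (x^2)^i * (y^2)^j * (z^2)^(n-i-j))"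
      unfolding A by (intro sum.cong refl) (simp add: BA)
    finally show "markovM a b x y z = (\<Sum>i\<le>n. \<Sum>j\<le>n-i. B (int i) (int j) * (x^2)^i * (y^2)^j * (z^2)^(n-i-j))
        / (x^(a-1) * y^(b-1) * z^n)" .
  qed (auto simp: B_def split: if_splits)
  then have AB: "markovA a b = B"
    unfolding markovA_def using is_markovP_unique by blast
  show "markovA a b i j = 0" if "\<not> (0 \<le> i \<and> 0 \<le> j \<and> i + j \<le> int n)" for i j
    using that by (simp only: AB B_def if_False)
  fix t :: real assume t: "0 < t"
  obtain D where D: "((\<lambda>w. F t 1 w) has_real_derivative D) (at 0)"
     "D * (t+1)^2 = (if a = 0 then 0 else ((real b - 1) * t + (real a - 1)) * (t+1)^n)"
    using markov_numD(5)[OF F] t unfolding wslice_def n_def by blast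
  have "D = (\<Sum>i<n. A i (n-1-i) * t^i)"
    by (rule DERIV_unique[OF D(1)[unfolded A] DERIV_homogeneous_w])
  also have "\<dots> = (\<Sum>i<n. markovA a b (int i) (int (n-1-i)) * t^i)"
    unfolding AB by (intro sum.cong refl) (subst BA, auto)
  finally show "(\<Sum>i<n. markovA a b (int i) (int (n-1-i)) * t^i) * (t+1)^2
      = ((real b - 1) * t + (real a - 1)) * (t+1)^n"
    using D(2) ab(1) by simp
  obtain E where E: "((\<lambda>v. F t v 1) has_real_derivative E) (at 0)"
     "E * (t+1)^2 = (if b = 1 then real a * (t+1)^2
          else t^a * (t+1)^(b-1) * ((real a + real b - 1) * t + (3 * real a - 1)))"
    using markov_numD(6)[OF F] t unfolding vslice_def by blast
  have "E = (\<Sum>i<n. A i 1 * t^i)"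
    by (rule DERIV_unique[OF E(1)[unfolded A] DERIV_homogeneous_v])
  also have "\<dots> = (\<Sum>i<n. markovA a b (int i) 1 * t^i)"
    unfolding AB by (intro sum.cong refl) (use BA[of _ 1] in auto)
  finally show "(\<Sum>i<n. markovA a b (int i) 1 * t^i) * (t+1)^2
      = (if b = 1 then real a * (t+1)^2
         else t^a * (t+1)^(b-1) * ((real a + real b - 1) * t + (3 * real a - 1)))"
    using E(2) by simp
qed

text \<open>Cancelling \<open>(t+1)^2\<close> leaves a linear form times
  \<open>(t+1)^(a+b-3)\<close>, where \<open>2 \<le> b\<close> rules out truncation. Both sides
  vanish off the line segment, so \<open>i\<close> ranges over all integers and the neighbours of an
  end point are covered.\<close>

lemma markovA_w_line:
  assumes ab: "1 \<le> a" "a \<le> b" "coprime a b" and "2 \<le> b"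
  shows "markovA a b i (int a + int b - 2 - i)
    = (real a - 1) * ibinom (a+b-3) i + (real b - 1) * ibinom (a+b-3) (i-1)"
proof -
  define m where "m = a + b - 3"
  have n: "a + b - 1 = Suc (Suc m)" "int a + int b - 2 = int (Suc m)"
    using ab assms(4) by (auto simp: m_def)
  note lines = markovA_lines[OF ab, unfolded n]
  have t2: "(t+1)^2 \<noteq> 0" if "0 < t" for t :: real using that by simp
  show ?thesis
  proof (cases "0 \<le> i \<and> i \<le> int (Suc m)")
    case True
    have "markovA a b (int (nat i)) (int (Suc m - nat i))
        = (real a - 1) * ibinom m (int (nat i)) + (real b - 1) * ibinom m (int (nat i) - 1)"
    proof (rule polyfun_pos_unique[where n = "Suc m" and f = "\<lambda>i. markovA a b (int i) (int (Suc m - i))"])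
      fix t :: real assume t: "0 < t"
      have "(\<Sum>i\<le>Suc m. markovA a b (int i) (int (Suc m - i)) * t^i) * (t+1)^2
          = ((real b - 1) * t + (real a - 1)) * (t+1)^(Suc (Suc m))"
        using lines(2)[OF t] by (simp only: lessThan_Suc_atMost diff_Suc_1)
      also have "\<dots> = ((real a - 1) + (real b - 1) * t) * (t+1)^m * (t+1)^2"
        by (simp add: power2_eq_square mult_ac add.commute)
      finally show "(\<Sum>i\<le>Suc m. markovA a b (int i) (int (Suc m - i)) * t^i)
        = (\<Sum>i\<le>Suc m. ((real a - 1) * ibinom m (int i) + (real b - 1) * ibinom m (int i - 1)) * t^i)"
        unfolding sum_linear_ibinom using t2[OF t] by (simp only: mult_cancel_right simp_thms)
    qed (use True in auto)
    moreover have "int (Suc m - nat i) = int a + int b - 2 - i" "int (nat i) = i"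
      using True n(2) by linarith+
    ultimately show ?thesis by (simp only: m_def)
  next
    case False
    have "markovA a b i (int a + int b - 2 - i) = 0"
      by (rule lines(1)) (use False n(2) in auto)
    moreover have "ibinom m i = 0" "ibinom m (i - 1) = 0"
      using False by (auto intro!: ibinom_eq_0)
    ultimately show ?thesis by (simp add: m_def)
  qed
qed

text \<open>Here \<open>3 \<le> b\<close> makes \<open>(t+1)^(b-3)\<close> the true quotient, and
  the factor \<open>t^a\<close> moves the row of binomials to start at \<open>i = a\<close>.\<close>

lemma markovA_v_line:
  assumes ab: "1 \<le> a" "a \<le> b" "coprime a b" and "3 \<le> b"
  shows "markovA a b i 1 = (3 * real a - 1) * ibinom (b-3) (i - int a)
    + (real a + real b - 1) * ibinom (b-3) (i - int a - 1)"
proof -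
  define m where "m = b - 3"
  have b: "b = m + 3" using assms(4) by (simp add: m_def)
  have b1: "b \<noteq> 1" "b - 1 = m + 2" by (simp_all add: b)
  have n: "a + b - 1 = Suc (a + Suc m)" by (simp add: b)
  note lines = markovA_lines[OF ab, unfolded n]
  have t2: "(t+1)^2 \<noteq> 0" if "0 < t" for t :: real using that by simp
  let ?f = "\<lambda>k. (3 * real a - 1) * ibinom m k + (real a + real b - 1) * ibinom m (k - 1)"
  show ?thesis
  proof (cases "0 \<le> i \<and> i \<le> int (a + Suc m)")
    case True
    have "markovA a b (int (nat i)) 1 = ?f (int (nat i) - int a)"
    proof (rule polyfun_pos_unique[where n = "a + Suc m" and f = "\<lambda>i. markovA a b (int i) 1"])
      fix t :: real assume t: "0 < t"
      have "(\<Sum>i\<le>a + Suc m. markovA a b (int i) 1 * t^i) * (t+1)^2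
          = t^a * (t+1)^(m+2) * ((real a + real b - 1) * t + (3 * real a - 1))"
        using lines(3)[OF t] b1 by (simp only: lessThan_Suc_atMost if_False)
      also have "\<dots> = t^a * (((3 * real a - 1) + (real a + real b - 1) * t) * (t+1)^m) * (t+1)^2"
        by (simp add: power_add power2_eq_square mult_ac add.commute)
      also have "t^a * (((3 * real a - 1) + (real a + real b - 1) * t) * (t+1)^m)
          = (\<Sum>i\<le>a + Suc m. ?f (int i - int a) * t^i)"
        unfolding sum_linear_ibinom[symmetric]
        by (rule sum_shift[symmetric]) (simp add: ibinom_eq_0)
      finally show "(\<Sum>i\<le>a + Suc m. markovA a b (int i) 1 * t^i) = (\<Sum>i\<le>a + Suc m. ?f (int i - int a) * t^i)"
        using t2[OF t] by (simp only: mult_cancel_right simp_thms)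
    qed (use True in auto)
    then show ?thesis using True by (simp add: m_def)
  next
    case False
    have "markovA a b i 1 = 0"
      by (rule lines(1)) (use False in auto)
    moreover have "ibinom m (i - int a) = 0" "ibinom m (i - int a - 1) = 0"
      using False by (auto intro!: ibinom_eq_0)
    ultimately show ?thesis by (simp add: m_def)
  qed
qed

theorem theorem6p6:
  fixes a b :: nat
  assumes "1 \<le> a" and "a \<le> b" and "coprime a b"
  shows "(\<forall>i::int. in_Delta a b i 1 \<longrightarrow>
            (markovA a b i 1)^2 > markovA a b (i-1) 1 * markovA a b (i+1) 1)
       \<and> (\<forall>i j::int. in_Delta a b i j \<and> i + j = int a + int b - 2 \<longrightarrow>
            (markovA a b i j)^2 > markovA a b (i-1) (j+1) * markovA a b (i+1) (j-1))"
proof (intro conjI allI impI)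
  note lines = markovA_lines[OF assms]
  have ab: "a < b" if "2 \<le> b"
    using assms that by (cases "a = b") auto
  fix i :: int assume "in_Delta a b i 1"
  then have i: "0 \<le> i" "i + 1 \<le> int a + int b - 1"
    and "1 \<le> real_of_int i / real a + 1 / real b"
    by (auto simp: in_Delta_def)
  then have "real a * real b \<le> real_of_int i * real b + real a"
    using assms by (simp add: field_simps)
  then have "real_of_int (int a * int b) \<le> real_of_int (i * int b + int a)" by simp
  then have le: "int a * int b \<le> i * int b + int a" unfolding of_int_le_iff .
  \<comment> \<open>For \<open>i \<le> a-1\<close> the inequality \<open>le\<close> would give
    \<open>b \<le> a\<close>, so the region meets the line \<open>j = 1\<close> only where the
    coefficients are positive.\<close>
  have ia: "int a \<le> i" if "2 \<le> b"
  proof (rule ccontr)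
    assume "\<not> int a \<le> i"
    then have "(i + 1) * int b \<le> int a * int b" by (intro mult_right_mono) auto
    then show False using le ab[OF that] by (simp add: algebra_simps)
  qed
  consider "b = 1" | "b = 2" | "3 \<le> b" using assms by linarith
  then show "markovA a b (i-1) 1 * markovA a b (i+1) 1 < (markovA a b i 1)^2"
  proof cases
    case 1
    then have a: "a = 1" and "i = 0" using assms i by auto
    moreover have "markovA a b 0 1 = 1" using lines(3)[of 1] 1 a by simp
    moreover have "markovA a b (-1) 1 = 0" by (rule lines(1)) simp
    ultimately show ?thesis by simp
  next
    case 2
    \<comment> \<open>Now \<open>b - 3\<close> would be truncated, so the coefficients are read off
      directly: \<open>t * (t+1) * (2*t+2) = 2*t * (t+1)^2\<close>.\<close>
    then have a: "a = 1" and i1: "i = 1" using ab ia i assms(1) by auto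
    have "markovA a b (int 1) 1 = 2"
    proof -
      have "markovA a b (int i) 1 = (if i = 1 then 2 else 0)" if "i \<le> 1" for i
      proof (rule polyfun_pos_unique[OF _ that])
        fix t :: real assume t: "0 < t"
        have "(\<Sum>i\<le>1. markovA a b (int i) 1 * t^i) * (t+1)^2 = t * (t+1) * (2 * t + 2)"
          using lines(3)[OF t] 2 a by (simp add: lessThan_Suc_atMost numeral_2_eq_2)
        also have "\<dots> = (2 * t) * (t+1)^2"
          by (simp add: power2_eq_square algebra_simps)
        finally show "(\<Sum>i\<le>1. markovA a b (int i) 1 * t^i) = (\<Sum>i\<le>1. (if i = 1 then 2 else 0) * t^i)"
          using t by simp
      qed
      from this[of 1] show ?thesis by simp
    qed
    moreover have "markovA a b 2 1 = 0" by (rule lines(1)) (simp add: 2 a)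
    ultimately show ?thesis using i1 by simp
  next
    case 3
    let ?f = "\<lambda>k. (3 * real a - 1) * ibinom (b-3) k + (real a + real b - 1) * ibinom (b-3) (k - 1)"
    have slc: "slc (\<lambda>k. ?f (k - int a))"
      by (rule slc_shift, rule slc_linear[OF slc_ibinom]) (use assms in auto)
    have nn: "0 \<le> ibinom (b-3) k" for k using slcD(1)[OF slc_ibinom] .
    \<comment> \<open>Strictness requires a positive middle term: at \<open>i = a\<close> the first
      summand provides it, further right the second.\<close>
    have "0 < ?f (i - int a)"
    proof (cases "i = int a")
      case True
      then show ?thesis using assms ibinom_pos[of 0 "b-3"] nn
        by (intro add_pos_nonneg mult_pos_pos) auto
    next
      case False
      have "0 < ibinom (b-3) (i - int a - 1)"
        using False ia i 3 by (intro ibinom_pos) auto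
      then show ?thesis using assms nn
        by (intro add_nonneg_pos mult_pos_pos mult_nonneg_nonneg) auto
    qed
    from slcD(3)[OF slc this] show ?thesis
      unfolding markovA_v_line[OF assms 3] .
  qed
next
  fix i j :: int assume "in_Delta a b i j \<and> i + j = int a + int b - 2"
  then have ij: "0 \<le> i" "0 \<le> j" "j = int a + int b - 2 - i"
    and D: "1 \<le> real_of_int i / real a + real_of_int j / real b"
    by (auto simp: in_Delta_def)
  \<comment> \<open>For \<open>b = 1\<close> the line meets the quadrant only at the origin, which
    lies below \<open>i/a + j/b = 1\<close>.\<close>
  have b: "2 \<le> b"
  proof (rule ccontr)
    assume "\<not> 2 \<le> b"
    then have "i = 0" "j = 0" using ij assms by auto
    then show False using D by simp
  qed
  let ?f = "\<lambda>k. (real a - 1) * ibinom (a+b-3) k + (real b - 1) * ibinom (a+b-3) (k - 1)"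
  have slc: "slc ?f"
    by (rule slc_linear[OF slc_ibinom]) (use assms in auto)
  have nn: "0 \<le> ibinom (a+b-3) k" for k using slcD(1)[OF slc_ibinom] .
  have "0 < ?f i"
  proof (cases "i = 0")
    case True
    \<comment> \<open>The point \<open>(0, a+b-2)\<close> lies in the region only if
      \<open>a+b-2\<close> is at least \<open>b\<close>; this keeps the coefficient
      \<open>a-1\<close> positive.\<close>
    have "a \<noteq> 1"
      using D True ij(3) b by (auto simp: field_simps)
    then show ?thesis using assms True ibinom_pos[of 0 "a+b-3"] nn
      by (intro add_pos_nonneg mult_pos_pos) auto
  next
    case False
    have "0 < ibinom (a+b-3) (i - 1)"
      using False ij b assms(1) by (intro ibinom_pos) auto
    then show ?thesis using assms b nn
      by (intro add_nonneg_pos mult_pos_pos mult_nonneg_nonneg) auto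
  qed
  from slcD(3)[OF slc this]
  have "markovA a b (i-1) (int a + int b - 2 - (i-1)) * markovA a b (i+1) (int a + int b - 2 - (i+1))
      < (markovA a b i (int a + int b - 2 - i))^2"
    unfolding markovA_w_line[OF assms b] .
  moreover have "int a + int b - 2 - (i-1) = j + 1" "int a + int b - 2 - (i+1) = j - 1"
    using ij(3) by auto
  ultimately show "markovA a b (i-1) (j+1) * markovA a b (i+1) (j-1) < (markovA a b i j)^2"
    using ij(3) by simp
qed

end
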